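(* Let $X_{0-}\ge 0$ be a random variable with a density $f$ on $[0,\infty)$ such that $f\le 1$ and $\int_0^\infty x f(x)\,\mathrm{d}x<\infty$. Suppose there exist a continuous non-decreasing function $g:(0,\infty)\to(0,\infty)$ and a $\lambda_0>0$ such that for all $\lambda\in(0,\lambda_0)$ and all $\mu\in[0,1]$, $$\int_\mu^{\mu+1} f(\lambda x)\,\mathrm{d}x\le 1-g\big(\lambda(\mu+1)\big).$$ Then the physical solution $(X,\Lambda)$ of the probabilistic supercooled Stefan problem started from $X_{0-}$ is unique: if $(X,\Lambda)$ and $(\widetilde X,\widetilde\Lambda)$ are two physical solutions started from $X_{0-}$ (with the same Brownian motion $B$), then $\Lambda_t=\widetilde\Lambda_t$ for all $t\ge0$ (and hence $X=\widetilde X$).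
   Context: Let $X_{0-}\ge0$ be a random variable and $B=(B_t)_{t\ge0}$ an independent standard Brownian motion. A solution of the probabilistic supercooled Stefan problem started from $X_{0-}$ is a pair $(X,\Lambda)$ with $\Lambda:[0,\infty)\to[0,1]$ deterministic such that $$X_t=X_{0-}+B_t-\Lambda_t,\quad t\ge0;\qquad \tau:=\inf\{t\ge0:\,X_t\le0\};\qquad \Lambda_t=\mathbb{P}(\tau\le t),\quad t\ge0.$$ (Then $\Lambda$ is non-decreasing and right-continuous with left limits.) Set $\Lambda_{0-}:=0$, and for $t>0$ let $\Lambda_{t-}$, $X_{t-}$ denote left limits. The solution is called physical if for all $t\ge0$ $$\Lambda_t-\Lambda_{t-}=\inf\big\{x>0:\ \mathbb{P}(\tau\ge t,\,X_{t-}\in(0,x])<x\big\}.$$ *)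

theory Defs
  imports "HOL-Probability.Probability"
begin

text \<open>With values in the extended reals, so that the infimum of the empty set is infinity.\<close>

definition hitting_time :: "(real \<Rightarrow> 'a \<Rightarrow> real) \<Rightarrow> 'a \<Rightarrow> ereal" where
  "hitting_time X \<omega> = Inf (ereal ` {t. 0 \<le> t \<and> X t \<omega> \<le> 0})"

text \<open>
  Left limit of a path indexed by nonnegative times; the value \<open>y\<close> at time \<open>0-\<close> is prescribed
  separately. \<^const>\<open>Lim\<close> is meaningful only where the limit exists; for the solutions defined below
  it always does, since \<open>B\<close> has continuous paths and \<open>\<Lambda>\<close> is non-decreasing.
\<close>

definition left_limit :: "real \<Rightarrow> (real \<Rightarrow> real) \<Rightarrow> real \<Rightarrow> real" where
  "left_limit y h t = (if t = 0 then y else Lim (at_left t) h)"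

context prob_space
begin

text \<open>Processes are functions on all of \<^typ>\<open>real\<close>, of which only the times \<open>t \<ge> 0\<close> matter.\<close>

definition standard_brownian_motion :: "(real \<Rightarrow> 'a \<Rightarrow> real) \<Rightarrow> bool" where
  "standard_brownian_motion B \<longleftrightarrow>
     (\<forall>t\<ge>0. random_variable borel (B t)) \<and>
     (AE \<omega> in M. B 0 \<omega> = 0) \<and>
     (\<forall>\<omega>\<in>space M. continuous_on {0..} (\<lambda>t. B t \<omega>)) \<and>
     (\<forall>s t. 0 \<le> s \<and> s < t \<longrightarrow>
        distributed M lborel (\<lambda>\<omega>. B t \<omega> - B s \<omega>) (normal_density 0 (sqrt (t - s)))) \<and>
     (\<forall>(n::nat) u. 0 \<le> u 0 \<and> incseq u \<longrightarrow>
        indep_vars (\<lambda>_. borel) (\<lambda>i \<omega>. B (u (Suc i)) \<omega> - B (u i) \<omega>) {..<n})"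

text \<open>
  Independence of the sigma-algebras generated by \<open>Y\<close> and by the whole process \<open>B\<close>
  (\<^const>\<open>indep_var\<close> would require both random variables to take values in the same type).
\<close>

definition indep_of_process :: "('a \<Rightarrow> real) \<Rightarrow> (real \<Rightarrow> 'a \<Rightarrow> real) \<Rightarrow> bool" where
  "indep_of_process Y B \<longleftrightarrow>
     indep_set
       (sets (vimage_algebra (space M) Y borel))
       (sets (vimage_algebra (space M) (\<lambda>\<omega>. \<lambda>t\<in>{0..}. B t \<omega>) (Pi\<^sub>M {0..} (\<lambda>_. borel))))"

text \<open>
  \<open>X0\<close> is the initial value \<open>X\<close> at time \<open>0-\<close>. Measurability of the hitting time is what
  gives \<open>\<Lambda> t = P(\<tau> \<le> t)\<close> a meaning (\<^const>\<open>prob\<close> is \<open>0\<close> on non-measurable sets).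
\<close>

definition stefan_solution ::
  "('a \<Rightarrow> real) \<Rightarrow> (real \<Rightarrow> 'a \<Rightarrow> real) \<Rightarrow> (real \<Rightarrow> 'a \<Rightarrow> real) \<Rightarrow> (real \<Rightarrow> real) \<Rightarrow> bool" where
  "stefan_solution X0 B X \<Lambda> \<longleftrightarrow>
     (\<forall>t\<ge>0. \<Lambda> t \<in> {0..1}) \<and>
     (\<forall>t\<ge>0. \<forall>\<omega>\<in>space M. X t \<omega> = X0 \<omega> + B t \<omega> - \<Lambda> t) \<and>
     random_variable borel (hitting_time X) \<and>
     (\<forall>t\<ge>0. \<Lambda> t = prob {\<omega> \<in> space M. hitting_time X \<omega> \<le> ereal t})"

definition physical_solution ::
  "('a \<Rightarrow> real) \<Rightarrow> (real \<Rightarrow> 'a \<Rightarrow> real) \<Rightarrow> (real \<Rightarrow> 'a \<Rightarrow> real) \<Rightarrow> (real \<Rightarrow> real) \<Rightarrow> bool" where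
  "physical_solution X0 B X \<Lambda> \<longleftrightarrow>
     stefan_solution X0 B X \<Lambda> \<and>
     (\<forall>t\<ge>0. \<Lambda> t - left_limit 0 \<Lambda> t =
        Inf {x. 0 < x \<and>
          prob {\<omega> \<in> space M. ereal t \<le> hitting_time X \<omega> \<and>
                              left_limit (X0 \<omega>) (\<lambda>s. X s \<omega>) t \<in> {0<..x}} < x})"

end

end

theory Submission
  imports Defs
begin

text \<open>
  Write \<open>F\<close> for the distribution function of \<open>X0\<close>. Then \<open>\<Lambda> t = E F(S t)\<close>, where \<open>S t\<close> is the supremum
  of \<open>\<Lambda> - B\<close> over \<open>[0, t]\<close>. Let \<open>d\<close> be the supremum of the distance between two solutions. Since
  \<open>f \<le> 1\<close>, \<open>F\<close> is 1-Lipschitz, so passing from \<open>\<Lambda>\<close> to \<open>E F(S t)\<close> does not increase \<open>d\<close>; it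
  gains a factor because windows of length \<open>d\<close> far to the right have probability at most \<open>d / 2\<close>
  and \<open>S t\<close> gets there with a probability bounded away from \<open>0\<close> for \<open>t \<ge> t0 > 0\<close>. Before \<open>t0\<close>
  both solutions are below \<open>d / 2\<close>, by right-continuity at \<open>0\<close> and \<open>\<Lambda> 0 = 0\<close>. The latter is the only
  place where physicality and the averaging condition (with \<open>\<mu> = 0\<close>) enter.
\<close>

context prob_space
begin

section \<open>Regularity of solutions, hitting times and running suprema\<close>

text \<open>Continuity of the measure from above along the times \<open>t + 1 / Suc n\<close>.
  Monotonicity extends the bound to every \<open>s\<close> below \<open>t + d\<close>, including
  those left of \<open>t\<close>. \<open>T\<close> is extended-real because a hitting time may be
  infinite.\<close>

lemma prob_le_right_continuous:
  fixes T :: "'a \<Rightarrow> ereal"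
  assumes T: "random_variable borel T" and "0 < e"
  shows "\<exists>d>0. \<forall>s<t + d. prob {\<omega>\<in>space M. T \<omega> \<le> ereal s} < prob {\<omega>\<in>space M. T \<omega> \<le> ereal t} + e"
proof -
  let ?A = "\<lambda>n::nat. {\<omega>\<in>space M. T \<omega> \<le> ereal (t + 1 / Suc n)}"
  have [measurable]: "T \<in> borel_measurable M" by (rule T)
  have lim: "(\<lambda>n. t + 1 / Suc n) \<longlonglongrightarrow> t"
    using tendsto_add[OF tendsto_const LIMSEQ_inverse_real_of_nat, of t] by (simp add: inverse_eq_divide)
  have "decseq ?A"
  proof (rule decseq_SucI, safe)
    fix n \<omega> assume "T \<omega> \<le> ereal (t + 1 / Suc (Suc n))"
    moreover have "t + 1 / Suc (Suc n) \<le> t + 1 / Suc n" by (simp add: field_simps)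
    ultimately show "T \<omega> \<le> ereal (t + 1 / Suc n)"
      by (meson ereal_less_eq(3) order_trans)
  qed
  moreover have "range ?A \<subseteq> events" by auto
  ultimately have "(\<lambda>n. prob (?A n)) \<longlonglongrightarrow> prob (\<Inter>n. ?A n)"
    by (rule finite_Lim_measure_decseq[rotated])
  moreover have "(\<Inter>n. ?A n) = {\<omega>\<in>space M. T \<omega> \<le> ereal t}"
  proof safe
    fix \<omega> assume *: "\<omega> \<in> (\<Inter>n. ?A n)"
    then show "\<omega> \<in> space M" by auto
    have "(\<lambda>n. ereal (t + 1 / Suc n)) \<longlonglongrightarrow> ereal t" using lim by simp
    then show "T \<omega> \<le> ereal t"
      by (rule LIMSEQ_le_const) (use * in auto)
  next
    fix \<omega> n assume "T \<omega> \<le> ereal t"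
    moreover have "ereal t \<le> ereal (t + 1 / Suc n)" by simp
    ultimately show "T \<omega> \<le> ereal (t + 1 / Suc n)" by (rule order_trans)
  qed
  ultimately have "\<forall>\<^sub>F n in sequentially. prob (?A n) < prob {\<omega>\<in>space M. T \<omega> \<le> ereal t} + e"
    using \<open>0 < e\<close> by (intro order_tendstoD(2)) auto
  then obtain n where n: "prob (?A n) < prob {\<omega>\<in>space M. T \<omega> \<le> ereal t} + e"
    by (auto simp: eventually_sequentially)
  show ?thesis
  proof (intro exI[of _ "1 / Suc n"] conjI allI impI)
    fix s assume s: "s < t + 1 / Suc n"
    have "{\<omega>\<in>space M. T \<omega> \<le> ereal s} \<subseteq> ?A n"
      using s by (auto elim!: order_trans)
    then have "prob {\<omega>\<in>space M. T \<omega> \<le> ereal s} \<le> prob (?A n)"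
      by (intro finite_measure_mono) auto
    then show "prob {\<omega>\<in>space M. T \<omega> \<le> ereal s} < prob {\<omega>\<in>space M. T \<omega> \<le> ereal t} + e"
      using n by simp
  qed simp
qed

lemma stefan_solution_right_continuous:
  assumes "stefan_solution X0 B X \<Lambda>" "0 \<le> t" "0 < e"
  shows "\<exists>d>0. \<forall>s. 0 \<le> s \<and> s < t + d \<longrightarrow> \<Lambda> s < \<Lambda> t + e"
  using prob_le_right_continuous[of "hitting_time X" e t] assms
  unfolding stefan_solution_def by fastforce

lemma stefan_solution_mono:
  assumes "stefan_solution X0 B X \<Lambda>" "0 \<le> s" "s \<le> t"
  shows "\<Lambda> s \<le> \<Lambda> t"
proof -
  have [measurable]: "hitting_time X \<in> borel_measurable M"
    using assms by (simp add: stefan_solution_def)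
  have "prob {\<omega>\<in>space M. hitting_time X \<omega> \<le> ereal s} \<le> prob {\<omega>\<in>space M. hitting_time X \<omega> \<le> ereal t}"
    using assms(3) by (intro finite_measure_mono) (auto elim!: order_trans)
  then show ?thesis using assms by (simp add: stefan_solution_def)
qed

lemma hitting_time_le:
  assumes "0 \<le> s" "X s \<omega> \<le> 0"
  shows "hitting_time X \<omega> \<le> ereal s"
  unfolding hitting_time_def using assms by (intro Inf_lower) auto

text \<open>The infimum defining the hitting time is attained: if \<open>X\<close> were positive at
  that time \<open>a\<close>, then continuity of \<open>B\<close> and right-continuity of
  \<open>\<Lambda>\<close> would keep it positive on an interval to the right of \<open>a\<close>,
  while before \<open>a\<close> there is no hit at all.\<close>

lemma stefan_solution_hit:
  assumes sol: "stefan_solution X0 B X \<Lambda>" and B: "continuous_on {0..} (\<lambda>t. B t \<omega>)"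
    and \<omega>: "\<omega> \<in> space M" and hit: "hitting_time X \<omega> \<le> ereal t"
  shows "\<exists>s\<in>{0..t}. X s \<omega> \<le> 0"
proof -
  have "0 \<le> hitting_time X \<omega>"
    unfolding hitting_time_def by (intro Inf_greatest) auto
  with hit obtain a where a: "hitting_time X \<omega> = ereal a" "0 \<le> a" "a \<le> t"
    by (cases "hitting_time X \<omega>") auto
  have X: "X s \<omega> = X0 \<omega> + B s \<omega> - \<Lambda> s" if "0 \<le> s" for s
    using sol \<omega> that by (auto simp: stefan_solution_def)
  have "X a \<omega> \<le> 0"
  proof (rule ccontr)
    assume "\<not> X a \<omega> \<le> 0"
    \<comment> \<open>Half of \<open>X a \<omega>\<close> is allotted to the increase of
      \<open>\<Lambda>\<close> and half to the change of \<open>B\<close>.\<close>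
    then have pos: "0 < X a \<omega> / 2" by simp
    obtain d where d: "d > 0" "\<And>s. 0 \<le> s \<Longrightarrow> s < a + d \<Longrightarrow> \<Lambda> s < \<Lambda> a + X a \<omega> / 2"
      using stefan_solution_right_continuous[OF sol a(2) pos] by blast
    obtain d' where d': "d' > 0" "\<And>s. 0 \<le> s \<Longrightarrow> dist s a < d' \<Longrightarrow> dist (B s \<omega>) (B a \<omega>) < X a \<omega> / 2"
      using B[unfolded continuous_on_iff, rule_format, of a] a(2) pos
      by (metis atLeast_iff)
    have "hitting_time X \<omega> < ereal (a + min d d')"
      using a(1) d(1) d'(1) by simp
    then obtain s where s: "0 \<le> s" "X s \<omega> \<le> 0" "s < a + min d d'"
      unfolding hitting_time_def Inf_less_iff by auto
    have "a \<le> s" using hitting_time_le[of s X \<omega>] s a by simp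
    then have "\<Lambda> s < \<Lambda> a + X a \<omega> / 2" "\<bar>B s \<omega> - B a \<omega>\<bar> < X a \<omega> / 2"
      using d(2)[of s] d'(2)[of s] s by (auto simp: dist_real_def)
    then show False
      using X[OF s(1)] X[OF a(2)] s(2) by linarith
  qed
  then show ?thesis using a by auto
qed

text \<open>
  The supremum runs over countably many times only; by monotonicity of \<open>\<Lambda>\<close> and continuity
  of \<open>b\<close> it still dominates the values at all times in \<open>[0, t]\<close>.
\<close>

lemma running_max_measurable:
  fixes b :: "real \<Rightarrow> 'a \<Rightarrow> real"
  assumes b: "\<And>s. 0 \<le> s \<Longrightarrow> b s \<in> borel_measurable N"
    and cont: "\<And>\<omega>. \<omega> \<in> space N \<Longrightarrow> continuous_on {0..} (\<lambda>s. b s \<omega>)"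
    and mono: "\<And>s u. 0 \<le> s \<Longrightarrow> s \<le> u \<Longrightarrow> \<Lambda> s \<le> \<Lambda> u" and "0 \<le> (t::real)"
  obtains S :: "'a \<Rightarrow> real" where "S \<in> borel_measurable N"
    "\<And>\<omega> s. \<omega> \<in> space N \<Longrightarrow> s \<in> {0..t} \<Longrightarrow> \<Lambda> s - b s \<omega> \<le> S \<omega>"
    "\<And>\<omega> c. \<omega> \<in> space N \<Longrightarrow> (\<And>s. s \<in> {0..t} \<Longrightarrow> \<Lambda> s - b s \<omega> \<le> c) \<Longrightarrow> S \<omega> \<le> c"
proof
  \<comment> \<open>Times below \<open>t\<close> are approximated by rationals from the right. The
    endpoint \<open>t\<close> may be irrational and has no points of [0, t] to its right, so it is
    added by hand.\<close>
  let ?D = "insert t (\<rat> \<inter> {0..t})"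
  let ?S = "\<lambda>\<omega>. SUP s\<in>?D. \<Lambda> s - b s \<omega>"
  have bdd: "bdd_above ((\<lambda>s. \<Lambda> s - b s \<omega>) ` ?D)" if \<omega>: "\<omega> \<in> space N" for \<omega>
  proof -
    have "compact ((\<lambda>s. b s \<omega>) ` {0..t})"
      by (intro compact_continuous_image continuous_on_subset[OF cont[OF \<omega>]]) auto
    then have "bdd_below ((\<lambda>s. b s \<omega>) ` {0..t})"
      by (intro bounded_imp_bdd_below compact_imp_bounded)
    then obtain m where m: "\<And>s. s \<in> {0..t} \<Longrightarrow> m \<le> b s \<omega>" unfolding bdd_below_def by blast
    show ?thesis
    proof (rule bdd_aboveI)
      fix x assume "x \<in> (\<lambda>s. \<Lambda> s - b s \<omega>) ` ?D"
      then obtain s where s: "s \<in> {0..t}" "x = \<Lambda> s - b s \<omega>" using \<open>0 \<le> t\<close> by auto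
      then show "x \<le> \<Lambda> t - m" using m[of s] mono[of s t] by auto
    qed
  qed
  have D_countable: "countable ?D" by (simp add: countable_rat countable_Int1)
  show "?S \<in> borel_measurable N"
  proof (rule borel_measurable_cSUP[OF D_countable _ bdd])
    fix i assume "i \<in> ?D"
    then have "0 \<le> i" using \<open>0 \<le> t\<close> by auto
    then show "(\<lambda>\<omega>. \<Lambda> i - b i \<omega>) \<in> borel_measurable N" using b by simp
  qed
  have D: "\<Lambda> s - b s \<omega> \<le> ?S \<omega>" if "\<omega> \<in> space N" "s \<in> ?D" for \<omega> s
    using that by (intro cSUP_upper bdd)
  show "\<Lambda> s - b s \<omega> \<le> ?S \<omega>" if \<omega>: "\<omega> \<in> space N" and s: "s \<in> {0..t}" for \<omega> s
  proof (cases "s = t")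
    case True then show ?thesis using D[OF \<omega>] by simp
  next
    case False
    show ?thesis
    proof (rule field_le_epsilon)
      fix e :: real assume "0 < e"
      obtain d where d: "d > 0" "\<And>u. 0 \<le> u \<Longrightarrow> dist u s < d \<Longrightarrow> dist (b u \<omega>) (b s \<omega>) < e"
        using cont[OF \<omega>, unfolded continuous_on_iff, rule_format, of s] s \<open>0 < e\<close>
        by (metis atLeast_iff atLeastAtMost_iff)
      \<comment> \<open>The rational must lie to the right of \<open>s\<close>: then
        \<open>\<Lambda>\<close> can only grow, whereas approximation from the left could lose a
        jump at \<open>s\<close>.\<close>
      obtain q where q: "q \<in> \<rat>" "s < q" "q < min t (s + d)"
        using Rats_dense_in_real[of s "min t (s + d)"] False s d(1) by auto
      have "\<bar>b q \<omega> - b s \<omega>\<bar> < e" using d(2)[of q] q s by (auto simp: dist_real_def)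
      moreover have "\<Lambda> q - b q \<omega> \<le> ?S \<omega>" using q s by (intro D[OF \<omega>]) auto
      moreover have "\<Lambda> s \<le> \<Lambda> q" using q s by (intro mono) auto
      ultimately show "\<Lambda> s - b s \<omega> \<le> ?S \<omega> + e" by linarith
    qed
  qed
  show "?S \<omega> \<le> c" if "\<omega> \<in> space N" "\<And>s. s \<in> {0..t} \<Longrightarrow> \<Lambda> s - b s \<omega> \<le> c" for \<omega> c
    using that \<open>0 \<le> t\<close> by (intro cSUP_least) auto
qed

section \<open>Probabilities of random windows and independence from the Brownian path\<close>

lemma distributed_density_le_one:
  assumes D: "distributed M lborel X p" and p: "\<And>x. p x \<le> 1" and "0 \<le> (d::real)"
  shows "prob {\<omega>\<in>space M. X \<omega> \<in> {a..a + d}} \<le> d"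
proof -
  have "emeasure M (X -` {a..a + d} \<inter> space M) = (\<integral>\<^sup>+x. p x * indicator {a..a + d} x \<partial>lborel)"
    by (rule distributed_emeasure[OF D]) simp
  also have "\<dots> \<le> (\<integral>\<^sup>+x. indicator {a..a + d} x \<partial>lborel)"
    using p by (intro nn_integral_mono) (auto split: split_indicator)
  also have "\<dots> = ennreal d" using \<open>0 \<le> d\<close> by simp
  finally have "emeasure M {\<omega>\<in>space M. X \<omega> \<in> {a..a + d}} \<le> ennreal d"
    by (simp add: vimage_def Int_def conj_commute)
  then show ?thesis using \<open>0 \<le> d\<close> by (simp add: emeasure_eq_measure)
qed

text \<open>By Fubini, the probability is the average over the law of \<open>S\<close> of the
  probability that \<open>Y\<close> lies in a fixed window \<open>{y..y + d}\<close>. This is at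
  most \<open>d\<close>, and at most \<open>d / 2\<close> where \<open>c \<le> y\<close>, which
  saves \<open>d / 2\<close> times the probability of \<open>c \<le> S\<close>.\<close>

lemma indep_window_prob_le:
  fixes Y S :: "'a \<Rightarrow> real"
  assumes ind: "indep_var borel Y borel S" and "0 \<le> d"
    and le: "\<And>y. prob {\<omega>\<in>space M. Y \<omega> \<in> {y..y + d}} \<le> d"
    and half: "\<And>y. c \<le> y \<Longrightarrow> prob {\<omega>\<in>space M. Y \<omega> \<in> {y..y + d}} \<le> d / 2"
  shows "prob {\<omega>\<in>space M. Y \<omega> \<in> {S \<omega>..S \<omega> + d}} \<le> d * (1 - prob {\<omega>\<in>space M. c \<le> S \<omega>} / 2)"
proof -
  have [measurable]: "Y \<in> borel_measurable M" "S \<in> borel_measurable M"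
    and eq: "distr M borel Y \<Otimes>\<^sub>M distr M borel S = distr M (borel \<Otimes>\<^sub>M borel) (\<lambda>x. (Y x, S x))"
    using ind unfolding indep_var_distribution_eq by auto
  interpret Y: prob_space "distr M borel Y" by (rule prob_space_distr) simp
  interpret S: prob_space "distr M borel S" by (rule prob_space_distr) simp
  interpret YS: pair_sigma_finite "distr M borel Y" "distr M borel S" ..
  let ?W = "{z::real\<times>real. snd z \<le> fst z \<and> fst z \<le> snd z + d}"
  let ?p = "prob {\<omega>\<in>space M. c \<le> S \<omega>}"
  have "{z\<in>space (borel \<Otimes>\<^sub>M borel). snd z \<le> fst z \<and> fst z \<le> snd z + d} \<in> sets (borel \<Otimes>\<^sub>M borel)"
    by measurable
  then have W: "?W \<in> sets (borel \<Otimes>\<^sub>M borel)"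
    by (simp add: space_pair_measure)
  have "emeasure M {\<omega>\<in>space M. Y \<omega> \<in> {S \<omega>..S \<omega> + d}}
      = emeasure (distr M (borel \<Otimes>\<^sub>M borel) (\<lambda>x. (Y x, S x))) ?W"
    by (subst emeasure_distr[OF _ W]) (auto intro!: arg_cong[where f="emeasure M"])
  also have "\<dots> = (\<integral>\<^sup>+y. emeasure (distr M borel Y) ((\<lambda>x. (x, y)) -` ?W) \<partial>distr M borel S)"
    unfolding eq[symmetric] by (rule YS.emeasure_pair_measure_alt2) (use W in simp)
  also have "\<dots> \<le> (\<integral>\<^sup>+y. ennreal (d - d / 2 * indicator {c..} y) \<partial>distr M borel S)"
  proof (rule nn_integral_mono)
    fix y :: real
    have "emeasure (distr M borel Y) ((\<lambda>x. (x, y)) -` ?W) = prob {\<omega>\<in>space M. Y \<omega> \<in> {y..y + d}}"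
      by (subst emeasure_distr) (auto simp: emeasure_eq_measure intro!: arg_cong[where f=prob])
    also have "\<dots> \<le> ennreal (d - d / 2 * indicator {c..} y)"
      using le[of y] half[of y] by (intro ennreal_leI) (auto split: split_indicator)
    finally show "emeasure (distr M borel Y) ((\<lambda>x. (x, y)) -` ?W) \<le> \<dots>" .
  qed
  also have "\<dots> = ennreal (\<integral>y. d - d / 2 * indicator {c..} y \<partial>distr M borel S)"
    using \<open>0 \<le> d\<close>
    by (intro nn_integral_eq_integral Bochner_Integration.integrable_diff integrable_mult_right)
       (auto split: split_indicator simp: S.emeasure_eq_measure)
  also have "(\<integral>y. d - d / 2 * indicator {c..} y \<partial>distr M borel S) = d - d / 2 * measure (distr M borel S) {c..}"
    using S.prob_space
    by (subst Bochner_Integration.integral_diff) (auto simp: S.emeasure_eq_measure simp del: times_divide_eq_left)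
  also have "measure (distr M borel S) {c..} = ?p"
    by (subst measure_distr) (auto intro!: arg_cong[where f=prob])
  also have "d - d / 2 * ?p = d * (1 - ?p / 2)"
    by (simp add: algebra_simps)
  \<comment> \<open>Passing from extended nonnegative to real numbers requires the right-hand side
    to be nonnegative, hence the bound of the probability by 1.\<close>
  finally show ?thesis
    using \<open>0 \<le> d\<close> prob_le_1[of "{\<omega>\<in>space M. c \<le> S \<omega>}"]
    by (subst (asm) emeasure_eq_measure) (auto simp: ennreal_le_iff)
qed

text \<open>Measurability of \<open>S\<close> with respect to the sigma-algebra generated by the
  path puts the sigma-algebra of \<open>S\<close> inside it, and independence passes to smaller
  families.\<close>

lemma indep_of_process_indep_var:
  assumes ind: "indep_of_process Y B" and Y: "random_variable borel Y"
    and S: "S \<in> borel_measurable (vimage_algebra (space M) (\<lambda>\<omega>. \<lambda>t\<in>{0..}. B t \<omega>) (Pi\<^sub>M {0..} (\<lambda>_. borel)))"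
      (is "_ \<in> borel_measurable ?V")
  shows "indep_var borel Y borel S"
proof -
  let ?U = "vimage_algebra (space M) Y borel"
  have ind': "indep_set (sets ?U) (sets ?V)"
    using ind by (simp add: indep_of_process_def)
  have Y': "Y \<in> borel_measurable ?U"
    by (rule measurable_vimage_algebra1) simp
  \<comment> \<open>Independence of the two families already says that their members are events, so
    measurability with respect to \<open>M\<close> comes for free.\<close>
  have "random_variable borel S"
  proof (rule measurableI)
    fix A :: "real set" assume "A \<in> sets borel"
    then show "S -` A \<inter> space M \<in> events"
      using measurable_sets[OF S] indep_setD_ev2[OF ind'] by auto
  qed simp
  moreover have "indep_set (sigma_sets (space M) {Y -` A \<inter> space M | A. A \<in> sets borel})
      (sigma_sets (space M) {S -` A \<inter> space M | A. A \<in> sets borel})"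
  proof -
    have "sigma_sets (space M) {Y -` A \<inter> space M | A. A \<in> sets borel} \<subseteq> sets ?U"
      using sets.sigma_sets_subset[of "{Y -` A \<inter> space M | A. A \<in> sets borel}" ?U] measurable_sets[OF Y']
      by auto
    moreover have "sigma_sets (space M) {S -` A \<inter> space M | A. A \<in> sets borel} \<subseteq> sets ?V"
      using sets.sigma_sets_subset[of "{S -` A \<inter> space M | A. A \<in> sets borel}" ?V] measurable_sets[OF S]
      by auto
    ultimately show ?thesis using ind' unfolding indep_sets2_eq by blast
  qed
  ultimately show ?thesis using Y unfolding indep_var_eq by blast
qed

lemma process_vimage_measurable:
  assumes "0 \<le> t"
  shows "B t \<in> borel_measurable (vimage_algebra (space M) (\<lambda>\<omega>. \<lambda>t\<in>{0..}. B t \<omega>) (Pi\<^sub>M {0..} (\<lambda>_. borel)))"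
    (is "_ \<in> borel_measurable ?V")
proof -
  have "(\<lambda>\<omega>. \<lambda>t\<in>{0..}. B t \<omega>) \<in> measurable ?V (Pi\<^sub>M {0..} (\<lambda>_. borel))"
    by (rule measurable_vimage_algebra1) (auto simp: space_PiM)
  then have "(\<lambda>\<omega>. (\<lambda>t\<in>{0..}. B t \<omega>) t) \<in> borel_measurable ?V"
    by (rule measurable_compose) (use assms in \<open>auto intro: measurable_component_singleton\<close>)
  then show ?thesis using assms by simp
qed

section \<open>Comparison of two solutions through the running supremum\<close>

text \<open>The Gaussian density is positive everywhere, so it charges every set of positive
  Lebesgue measure, in particular a half-line.\<close>

lemma brownian_motion_unbounded_below:
  assumes B: "standard_brownian_motion B" and "0 < t"
  shows "0 < prob {\<omega>\<in>space M. c \<le> - B t \<omega>}"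
proof -
  have [measurable]: "B t \<in> borel_measurable M" "B 0 \<in> borel_measurable M"
    using B \<open>0 < t\<close> by (auto simp: standard_brownian_motion_def)
  let ?p = "\<lambda>x. ennreal (normal_density 0 (sqrt t) x)"
  have "\<forall>s t. 0 \<le> s \<and> s < t \<longrightarrow>
      distributed M lborel (\<lambda>\<omega>. B t \<omega> - B s \<omega>) (normal_density 0 (sqrt (t - s)))"
    using B unfolding standard_brownian_motion_def by blast
  from this[rule_format, of 0 t] have D: "distributed M lborel (\<lambda>\<omega>. B t \<omega> - B 0 \<omega>) ?p"
    using \<open>0 < t\<close> by simp
  have "emeasure M ((\<lambda>\<omega>. B t \<omega> - B 0 \<omega>) -` {..-c} \<inter> space M) = (\<integral>\<^sup>+x. ?p x * indicator {..-c} x \<partial>lborel)"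
    by (rule distributed_emeasure[OF D]) simp
  moreover have "(\<integral>\<^sup>+x. ?p x * indicator {..-c} x \<partial>lborel) \<noteq> 0"
  proof
    assume "(\<integral>\<^sup>+x. ?p x * indicator {..-c} x \<partial>lborel) = 0"
    then have "AE x in lborel. ?p x * indicator {..-c} x = 0"
      by (subst (asm) nn_integral_0_iff_AE) auto
    then have "AE x in lborel. x \<notin> {..-c}"
    proof eventually_elim
      case (elim x)
      have "?p x \<noteq> 0" using normal_density_pos[of "sqrt t" 0 x] \<open>0 < t\<close> by (simp add: ennreal_eq_0_iff)
      with elim show ?case by (auto split: split_indicator_asm)
    qed
    then have "emeasure lborel {..-c} = 0"
      by (subst (asm) AE_iff_measurable[of "{..-c}"]) auto
    moreover have "emeasure lborel {-c - 1..-c} \<le> emeasure lborel {..-c}"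
      by (rule emeasure_mono) auto
    ultimately show False by simp
  qed
  \<comment> \<open>The Gaussian law is known for the increment from time 0, and \<open>B 0\<close>
    vanishes only almost surely, so the two events agree up to a null set.\<close>
  moreover have "emeasure M ((\<lambda>\<omega>. B t \<omega> - B 0 \<omega>) -` {..-c} \<inter> space M) = emeasure M {\<omega>\<in>space M. c \<le> - B t \<omega>}"
  proof (rule emeasure_eq_AE)
    have "AE \<omega> in M. B 0 \<omega> = 0" using B by (simp add: standard_brownian_motion_def)
    then show "AE x in M. (x \<in> (\<lambda>\<omega>. B t \<omega> - B 0 \<omega>) -` {..-c} \<inter> space M) = (x \<in> {\<omega>\<in>space M. c \<le> - B t \<omega>})"
      by eventually_elim auto
  qed auto
  ultimately have "emeasure M {\<omega>\<in>space M. c \<le> - B t \<omega>} \<noteq> 0" by simp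
  then show ?thesis by (simp add: emeasure_eq_measure zero_less_measure_iff)
qed

text \<open>Let \<open>S\<close> be the supremum of \<open>\<Lambda>' - B\<close> over [0, t]. If
  \<open>X\<close> hits by time \<open>t\<close> but \<open>X'\<close> does not, then
  \<open>X0\<close> lies in \<open>{S..S + d}\<close>: positivity of \<open>X'\<close> gives the
  lower bound, and \<open>close\<close> at a hit of \<open>X\<close> gives the upper one. The
  estimate is one-sided; exchanging the solutions yields the other side.\<close>

lemma stefan_solution_diff_le:
  assumes B: "standard_brownian_motion B" and ind: "indep_of_process X0 B"
    and X0: "random_variable borel X0"
    and sol: "stefan_solution X0 B X \<Lambda>" and sol': "stefan_solution X0 B X' \<Lambda>'"
    and "0 \<le> t0" "t0 \<le> t" "0 \<le> d"
    and close: "\<And>s. s \<in> {0..t} \<Longrightarrow> \<Lambda> s \<le> \<Lambda>' s + d"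
    and le: "\<And>y. prob {\<omega>\<in>space M. X0 \<omega> \<in> {y..y + d}} \<le> d"
    and half: "\<And>y. c \<le> y \<Longrightarrow> prob {\<omega>\<in>space M. X0 \<omega> \<in> {y..y + d}} \<le> d / 2"
  shows "\<Lambda> t - \<Lambda>' t \<le> d * (1 - prob {\<omega>\<in>space M. c \<le> - B t0 \<omega>} / 2)"
proof -
  have cont: "continuous_on {0..} (\<lambda>t. B t \<omega>)" if "\<omega> \<in> space M" for \<omega>
    using B that by (simp add: standard_brownian_motion_def)
  \<comment> \<open>\<open>S\<close> is constructed as measurable with respect to the path of
    \<open>B\<close> alone, which is what makes it independent of \<open>X0\<close>.\<close>
  let ?V = "vimage_algebra (space M) (\<lambda>\<omega>. \<lambda>t\<in>{0..}. B t \<omega>) (Pi\<^sub>M {0..} (\<lambda>_. borel :: real measure))"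
  have V: "space ?V = space M" by simp
  have "0 \<le> t" using \<open>0 \<le> t0\<close> \<open>t0 \<le> t\<close> by simp
  obtain S where S: "S \<in> borel_measurable ?V"
    and upper: "\<And>\<omega> s. \<omega> \<in> space M \<Longrightarrow> s \<in> {0..t} \<Longrightarrow> \<Lambda>' s - B s \<omega> \<le> S \<omega>"
    and least: "\<And>\<omega> c. \<omega> \<in> space M \<Longrightarrow> (\<And>s. s \<in> {0..t} \<Longrightarrow> \<Lambda>' s - B s \<omega> \<le> c) \<Longrightarrow> S \<omega> \<le> c"
  proof (rule running_max_measurable[of B ?V \<Lambda>' t, unfolded V])
    show "B s \<in> borel_measurable ?V" if "0 \<le> s" for s
      using that by (rule process_vimage_measurable)
    show "\<Lambda>' s \<le> \<Lambda>' u" if "0 \<le> s" "s \<le> u" for s u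
      using stefan_solution_mono[OF sol'] that .
  qed (use cont \<open>0 \<le> t\<close> in blast)+
  have iv: "indep_var borel X0 borel S"
    by (rule indep_of_process_indep_var[OF ind X0 S])
  have [measurable]: "S \<in> borel_measurable M" "X0 \<in> borel_measurable M" "B t0 \<in> borel_measurable M"
    "hitting_time X \<in> borel_measurable M" "hitting_time X' \<in> borel_measurable M"
    using indep_var_rv2[OF iv] X0 B \<open>0 \<le> t0\<close> sol sol'
    by (auto simp: standard_brownian_motion_def stefan_solution_def)
  let ?E = "{\<omega>\<in>space M. hitting_time X \<omega> \<le> ereal t}" and ?E' = "{\<omega>\<in>space M. hitting_time X' \<omega> \<le> ereal t}"
  let ?W = "{\<omega>\<in>space M. X0 \<omega> \<in> {S \<omega>..S \<omega> + d}}"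
  have "?E \<subseteq> ?E' \<union> ?W"
  proof
    fix \<omega> assume \<omega>: "\<omega> \<in> ?E"
    then have \<omega>M: "\<omega> \<in> space M" by simp
    obtain s where s: "s \<in> {0..t}" "X s \<omega> \<le> 0"
      using stefan_solution_hit[of X0 B X \<Lambda> \<omega> t] sol cont \<omega> by auto
    have "X0 \<omega> + B s \<omega> - \<Lambda> s \<le> 0" using s sol \<omega>M by (auto simp: stefan_solution_def)
    then have "X0 \<omega> \<le> S \<omega> + d" using upper[OF \<omega>M s(1)] close[OF s(1)] by linarith
    moreover have "S \<omega> \<le> X0 \<omega>" if not: "\<omega> \<notin> ?E'"
    proof (rule least[OF \<omega>M])
      fix u assume u: "u \<in> {0..t}"
      have "0 < X' u \<omega>"
      proof (rule ccontr)
        assume "\<not> 0 < X' u \<omega>"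
        then have "hitting_time X' \<omega> \<le> ereal u" using u by (intro hitting_time_le) auto
        also have "ereal u \<le> ereal t" using u by simp
        finally show False using not \<omega>M by simp
      qed
      then show "\<Lambda>' u - B u \<omega> \<le> X0 \<omega>" using u sol' \<omega>M by (auto simp: stefan_solution_def)
    qed
    ultimately show "\<omega> \<in> ?E' \<union> ?W" using \<omega>M by auto
  qed
  then have "prob ?E \<le> prob (?E' \<union> ?W)"
    by (intro finite_measure_mono) auto
  also have "\<dots> \<le> prob ?E' + prob ?W"
    by (intro measure_Un_le) auto
  finally have "\<Lambda> t - \<Lambda>' t \<le> prob ?W"
    using sol sol' \<open>0 \<le> t0\<close> \<open>t0 \<le> t\<close> by (simp add: stefan_solution_def)
  also have "\<dots> \<le> d * (1 - prob {\<omega>\<in>space M. c \<le> S \<omega>} / 2)"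
    by (rule indep_window_prob_le[OF iv \<open>0 \<le> d\<close> le half])
  \<comment> \<open>Evaluating at \<open>t0\<close> gives \<open>S \<ge> - B t0\<close>, since
    \<open>\<Lambda>'\<close> is nonnegative. The resulting factor no longer depends on
    \<open>t\<close>.\<close>
  also have "prob {\<omega>\<in>space M. c \<le> - B t0 \<omega>} \<le> prob {\<omega>\<in>space M. c \<le> S \<omega>}"
  proof (rule finite_measure_mono)
    have "0 \<le> \<Lambda>' t0" using sol' \<open>0 \<le> t0\<close> by (simp add: stefan_solution_def)
    then show "{\<omega>\<in>space M. c \<le> - B t0 \<omega>} \<subseteq> {\<omega>\<in>space M. c \<le> S \<omega>}"
      using upper[of _ t0] \<open>0 \<le> t0\<close> \<open>t0 \<le> t\<close> by fastforce
  qed simp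
  then have "d * (1 - prob {\<omega>\<in>space M. c \<le> S \<omega>} / 2) \<le> d * (1 - prob {\<omega>\<in>space M. c \<le> - B t0 \<omega>} / 2)"
    using \<open>0 \<le> d\<close> by (intro mult_left_mono) auto
  finally show ?thesis .
qed

section \<open>Absence of a jump at time 0, and properties of the initial law\<close>

text \<open>With left limits \<open>X0\<close> and 0 at time 0, the physical jump condition makes
  \<open>\<Lambda> 0\<close> an infimum over a set that contains every \<open>x\<close> in (0,
  l).\<close>

lemma physical_solution_initial:
  assumes phys: "physical_solution X0 B X \<Lambda>" and X0: "random_variable borel X0" and "0 < l"
    and small: "\<And>x. 0 < x \<Longrightarrow> x < l \<Longrightarrow> prob {\<omega>\<in>space M. X0 \<omega> \<in> {0..x}} < x"
  shows "\<Lambda> 0 = 0"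
proof -
  have [measurable]: "X0 \<in> borel_measurable M" by (rule X0)
  let ?A = "{x. 0 < x \<and> prob {\<omega> \<in> space M. ereal 0 \<le> hitting_time X \<omega> \<and> X0 \<omega> \<in> {0<..x}} < x}"
  have eq: "\<Lambda> 0 = Inf ?A" and "0 \<le> \<Lambda> 0"
    using phys by (auto simp: physical_solution_def stefan_solution_def left_limit_def)
  have "\<Lambda> 0 \<le> x" if x: "0 < x" "x < l" for x
  proof -
    have "prob {\<omega> \<in> space M. ereal 0 \<le> hitting_time X \<omega> \<and> X0 \<omega> \<in> {0<..x}}
        \<le> prob {\<omega>\<in>space M. X0 \<omega> \<in> {0..x}}"
      by (intro finite_measure_mono) auto
    then have "x \<in> ?A" using small[OF x] x by simp
    then show ?thesis unfolding eq by (intro cInf_lower) (auto intro!: bdd_belowI[of _ 0])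
  qed
  note le = this
  show ?thesis
  proof (rule ccontr)
    assume "\<Lambda> 0 \<noteq> 0"
    \<comment> \<open>The witness lies in (0, l) and strictly below
      \<open>\<Lambda> 0\<close>.\<close>
    with \<open>0 \<le> \<Lambda> 0\<close> \<open>0 < l\<close> le[of "min (l / 2) (\<Lambda> 0 / 2)"] show False
      by linarith
  qed
qed

lemma tail_prob_le:
  fixes Y :: "'a \<Rightarrow> real"
  assumes Y: "random_variable borel Y" and "0 < e"
  obtains c where "prob {\<omega>\<in>space M. c \<le> Y \<omega>} \<le> e"
proof -
  have [measurable]: "Y \<in> borel_measurable M" by (rule Y)
  let ?A = "\<lambda>n::nat. {\<omega>\<in>space M. real n \<le> Y \<omega>}"
  have "(\<lambda>n. prob (?A n)) \<longlonglongrightarrow> prob (\<Inter>n. ?A n)"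
    by (rule finite_Lim_measure_decseq) (auto simp: decseq_def)
  moreover have "(\<Inter>n. ?A n) = {}"
    using reals_Archimedean2 by (fastforce simp: not_le[symmetric])
  ultimately have "\<forall>\<^sub>F n in sequentially. prob (?A n) < e"
    using \<open>0 < e\<close> by (intro order_tendstoD(2)) auto
  then obtain n where "prob (?A n) < e"
    by (auto simp: eventually_sequentially)
  then show ?thesis using that[of "real n"] by simp
qed

text \<open>The substitution \<open>y = l * x\<close> brings the probability into the form in which
  the averaging condition on the density is stated.\<close>

lemma distributed_initial_interval:
  assumes D: "distributed M lborel Y (\<lambda>x. ennreal (indicator {0..} x * f x))"
    and f: "\<And>x. 0 \<le> x \<Longrightarrow> 0 \<le> f x" "\<And>x. 0 \<le> x \<Longrightarrow> f x \<le> 1" and "0 < (l::real)"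
  shows "prob {\<omega>\<in>space M. Y \<omega> \<in> {0..l}} = l * (LBINT x:{0..1}. f (l * x))"
proof -
  let ?h = "\<lambda>x::real. indicator {0..} x * f x"
  have "(\<lambda>x. ennreal (?h x)) \<in> borel_measurable borel"
    using distributed_borel_measurable[OF D] by simp
  \<comment> \<open>Only the extended-valued density is known to be measurable; nonnegativity of
    \<open>f\<close> allows the real one to be recovered from it.\<close>
  then have "(\<lambda>x. enn2real (ennreal (?h x))) \<in> borel_measurable borel" by simp
  then have [measurable]: "?h \<in> borel_measurable borel"
    using f(1) by (subst (asm) enn2real_ennreal) (auto split: split_indicator)
  have scale: "indicator {0..l} (l * x) = (indicator {0..1} x :: real)" for x
    using \<open>0 < l\<close> by (auto split: split_indicator simp: zero_le_mult_iff)
  have eq: "?h (l * x) * indicator {0..l} (l * x) = indicator {0..1} x *\<^sub>R f (l * x)" for x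
    unfolding scale using \<open>0 < l\<close> by (auto split: split_indicator)
  \<comment> \<open>The Bochner integral of a non-integrable function is 0 by convention, so
    integrability has to be secured first; \<open>f \<le> 1\<close> provides the dominating
    indicator.\<close>
  have int: "integrable lborel (\<lambda>x. indicator {0..1} x *\<^sub>R f (l * x))"
  proof (rule Bochner_Integration.integrable_bound)
    show "integrable lborel (indicator {0..1::real} :: real \<Rightarrow> real)" by simp
    show "(\<lambda>x. indicator {0..1} x *\<^sub>R f (l * x)) \<in> borel_measurable lborel"
      unfolding eq[symmetric] by measurable
    show "AE x in lborel. norm (indicator {0..1} x *\<^sub>R f (l * x)) \<le> norm (indicator {0..1} x :: real)"
      using f \<open>0 < l\<close> by (auto split: split_indicator)
  qed
  have "emeasure M (Y -` {0..l} \<inter> space M) = (\<integral>\<^sup>+x. ennreal (?h x) * indicator {0..l} x \<partial>lborel)"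
    by (rule distributed_emeasure[OF D]) simp
  also have "\<dots> = (\<integral>\<^sup>+x. ennreal (?h x * indicator {0..l} x) \<partial>lborel)"
    by (intro nn_integral_cong) (auto split: split_indicator)
  also have "\<dots> = ennreal \<bar>l\<bar> * (\<integral>\<^sup>+x. ennreal (?h (0 + l * x) * indicator {0..l} (0 + l * x)) \<partial>lborel)"
    by (rule nn_integral_real_affine) (use \<open>0 < l\<close> in auto)
  also have "\<dots> = ennreal l * (\<integral>\<^sup>+x. ennreal (indicator {0..1} x *\<^sub>R f (l * x)) \<partial>lborel)"
    unfolding add_0 eq using \<open>0 < l\<close> by simp
  also have "(\<integral>\<^sup>+x. ennreal (indicator {0..1} x *\<^sub>R f (l * x)) \<partial>lborel) = ennreal (LBINT x:{0..1}. f (l * x))"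
    unfolding set_lebesgue_integral_def
    by (rule nn_integral_eq_integral[OF int]) (use f \<open>0 < l\<close> in \<open>auto split: split_indicator\<close>)
  also have "ennreal l * \<dots> = ennreal (l * (LBINT x:{0..1}. f (l * x)))"
    using \<open>0 < l\<close> by (simp add: ennreal_mult')
  finally have *: "ennreal (prob {\<omega>\<in>space M. Y \<omega> \<in> {0..l}}) = ennreal (l * (LBINT x:{0..1}. f (l * x)))"
    by (simp add: emeasure_eq_measure vimage_def Int_def conj_commute)
  have "0 \<le> (LBINT x:{0..1}. f (l * x))"
    unfolding set_lebesgue_integral_def
    by (rule Bochner_Integration.integral_nonneg) (use f \<open>0 < l\<close> in \<open>auto split: split_indicator\<close>)
  then show ?thesis using * \<open>0 < l\<close> by (subst (asm) ennreal_inj) auto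
qed

section \<open>Uniqueness by contraction of the supremum distance\<close>

text \<open>The supremum \<open>d\<close> over all times need not be attained, so a contradiction
  needs one bound below \<open>d\<close> valid at every time. The constants \<open>c\<close>,
  \<open>t0\<close> and \<open>q\<close> may depend on \<open>d\<close> but not on the time.\<close>

lemma stefan_solution_unique:
  assumes B: "standard_brownian_motion B" and ind: "indep_of_process X0 B"
    and D: "distributed M lborel X0 p" and p: "\<And>x. p x \<le> 1"
    and sol: "stefan_solution X0 B X \<Lambda>" and sol': "stefan_solution X0 B X' \<Lambda>'"
    and init: "\<Lambda> 0 = 0" "\<Lambda>' 0 = 0" and "0 \<le> t"
  shows "\<Lambda> t = \<Lambda>' t"
proof (rule ccontr)
  assume neq: "\<Lambda> t \<noteq> \<Lambda>' t"
  have X0[measurable]: "X0 \<in> borel_measurable M"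
    using distributed_measurable[OF D] by simp
  have range: "0 \<le> \<Lambda> s" "\<Lambda> s \<le> 1" "0 \<le> \<Lambda>' s" "\<Lambda>' s \<le> 1" if "0 \<le> s" for s
    using sol sol' that by (auto simp: stefan_solution_def)
  define d where "d = (SUP s\<in>{0..}. \<bar>\<Lambda> s - \<Lambda>' s\<bar>)"
  have le_d: "\<bar>\<Lambda> s - \<Lambda>' s\<bar> \<le> d" if "0 \<le> s" for s
    unfolding d_def
  proof (rule cSUP_upper)
    show "bdd_above ((\<lambda>s. \<bar>\<Lambda> s - \<Lambda>' s\<bar>) ` {0..})"
    proof (rule bdd_aboveI)
      fix x assume "x \<in> (\<lambda>s. \<bar>\<Lambda> s - \<Lambda>' s\<bar>) ` {0..}"
      then obtain s where "0 \<le> s" "x = \<bar>\<Lambda> s - \<Lambda>' s\<bar>" by auto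
      then show "x \<le> 1" using range[of s] by auto
    qed
  qed (use that in simp)
  have "0 < d" using le_d[OF \<open>0 \<le> t\<close>] neq by simp
  then have d2: "0 < d / 2" by simp
  \<comment> \<open>Every window starting at or beyond \<open>c\<close> lies in this tail, whose
    mass is at most \<open>d / 2\<close>.\<close>
  obtain c where c: "prob {\<omega>\<in>space M. c \<le> X0 \<omega>} \<le> d / 2"
    using tail_prob_le[OF X0 d2] .
  have le: "prob {\<omega>\<in>space M. X0 \<omega> \<in> {y..y + d}} \<le> d" for y
    using distributed_density_le_one[OF D p] \<open>0 < d\<close> by simp
  have half: "prob {\<omega>\<in>space M. X0 \<omega> \<in> {y..y + d}} \<le> d / 2" if "c \<le> y" for y
  proof -
    have "prob {\<omega>\<in>space M. X0 \<omega> \<in> {y..y + d}} \<le> prob {\<omega>\<in>space M. c \<le> X0 \<omega>}"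
      using that by (intro finite_measure_mono) auto
    then show ?thesis using c by simp
  qed
  obtain e where e: "0 < e" "\<And>s. 0 \<le> s \<Longrightarrow> s < e \<Longrightarrow> \<Lambda> s < d / 2"
    using stefan_solution_right_continuous[OF sol order_refl d2] init by auto
  obtain e' where e': "0 < e'" "\<And>s. 0 \<le> s \<Longrightarrow> s < e' \<Longrightarrow> \<Lambda>' s < d / 2"
    using stefan_solution_right_continuous[OF sol' order_refl d2] init by auto
  define t0 where "t0 = min e e' / 2"
  have t0: "0 < t0" "t0 < e" "t0 < e'" using e e' by (auto simp: t0_def)
  define q where "q = prob {\<omega>\<in>space M. c \<le> - B t0 \<omega>}"
  have "0 < q" unfolding q_def by (rule brownian_motion_unbounded_below[OF B t0(1)])
  have "d \<le> max (d / 2) (d * (1 - q / 2))"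
  proof -
    have "\<bar>\<Lambda> s - \<Lambda>' s\<bar> \<le> max (d / 2) (d * (1 - q / 2))" if s: "0 \<le> s" for s
    proof (cases "s < t0")
      case True
      \<comment> \<open>Two numbers in [0, d / 2) differ by less than \<open>d / 2\<close>.\<close>
      then have "\<Lambda> s < d / 2" "\<Lambda>' s < d / 2" using e(2)[of s] e'(2)[of s] s t0 by auto
      then show ?thesis using range[OF s] by auto
    next
      case False
      have close: "\<Lambda> u \<le> \<Lambda>' u + d" "\<Lambda>' u \<le> \<Lambda> u + d" if "u \<in> {0..s}" for u
        using le_d[of u] that by auto
      have "\<Lambda> s - \<Lambda>' s \<le> d * (1 - q / 2)"
        unfolding q_def
        by (rule stefan_solution_diff_le[OF B ind X0 sol sol']) (use t0 False \<open>0 < d\<close> close le half in auto)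
      moreover have "\<Lambda>' s - \<Lambda> s \<le> d * (1 - q / 2)"
        unfolding q_def
        by (rule stefan_solution_diff_le[OF B ind X0 sol' sol]) (use t0 False \<open>0 < d\<close> close le half in auto)
      ultimately show ?thesis by linarith
    qed
    then show ?thesis unfolding d_def by (intro cSUP_least) auto
  qed
  moreover have "d * (1 - q / 2) < d" using \<open>0 < d\<close> \<open>0 < q\<close> by (simp add: algebra_simps)
  ultimately show False using d2 by linarith
qed

end

theorem theorem1p1:
  fixes M :: "'a measure"
    and X0 :: "'a \<Rightarrow> real"
    and B X X' :: "real \<Rightarrow> 'a \<Rightarrow> real"
    and \<Lambda> \<Lambda>' f g :: "real \<Rightarrow> real"
    and l0 :: real
  assumes "prob_space M"
    and "prob_space.standard_brownian_motion M B"
    and "prob_space.indep_of_process M X0 B"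
    and "AE \<omega> in M. 0 \<le> X0 \<omega>"
    and "distributed M lborel X0 (\<lambda>x. ennreal (indicator {0..} x * f x))"
    and "\<forall>x\<ge>0. 0 \<le> f x"
    and "\<forall>x\<ge>0. f x \<le> 1"
    and "(\<integral>\<^sup>+x\<in>{0..}. ennreal (x * f x) \<partial>lborel) < \<infinity>"
    and "continuous_on {0<..} g"
    and "mono_on {0<..} g"
    and "\<forall>x>0. 0 < g x"
    and "0 < l0"
    and "\<forall>l\<in>{0<..<l0}. \<forall>\<mu>\<in>{0..1}.
           (LBINT x:{\<mu>..\<mu> + 1}. f (l * x)) \<le> 1 - g (l * (\<mu> + 1))"
    and "prob_space.physical_solution M X0 B X \<Lambda>"
    and "prob_space.physical_solution M X0 B X' \<Lambda>'"
  shows "(\<forall>t\<ge>0. \<Lambda> t = \<Lambda>' t) \<and> (\<forall>t\<ge>0. \<forall>\<omega>\<in>space M. X t \<omega> = X' t \<omega>)"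
proof -
  interpret prob_space M by fact
  have sol: "stefan_solution X0 B X \<Lambda>" and sol': "stefan_solution X0 B X' \<Lambda>'"
    using assms(14,15) by (simp_all add: physical_solution_def)
  have X0: "random_variable borel X0"
    using distributed_measurable[OF assms(5)] by simp
  have small: "prob {\<omega>\<in>space M. X0 \<omega> \<in> {0..x}} < x" if x: "0 < x" "x < l0" for x
  proof -
    \<comment> \<open>The averaging condition with \<open>\<mu> = 0\<close>; positivity of
      \<open>g\<close> at \<open>x\<close> makes the bound strictly smaller than 1.\<close>
    have "(LBINT y:{0..1}. f (x * y)) \<le> 1 - g x"
      using assms(13)[rule_format, of x 0] x by simp
    also have "\<dots> < 1" using assms(11) x by simp
    finally have "x * (LBINT y:{0..1}. f (x * y)) < x" using x by simp
    moreover have "prob {\<omega>\<in>space M. X0 \<omega> \<in> {0..x}} = x * (LBINT y:{0..1}. f (x * y))"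
      by (rule distributed_initial_interval[OF assms(5)]) (use assms(6,7) x in auto)
    ultimately show ?thesis by simp
  qed
  have density: "ennreal (indicator {0..} x * f x) \<le> 1" for x :: real
    using assms(7) by (auto split: split_indicator)
  have eq: "\<Lambda> t = \<Lambda>' t" if "0 \<le> t" for t
    by (rule stefan_solution_unique[OF assms(2,3,5) density sol sol'
          physical_solution_initial[OF assms(14) X0 assms(12) small]
          physical_solution_initial[OF assms(15) X0 assms(12) small] that])
  moreover have "X t \<omega> = X' t \<omega>" if "0 \<le> t" "\<omega> \<in> space M" for t \<omega>
    using sol sol' eq that by (simp add: stefan_solution_def)
  ultimately show ?thesis by blast
qed

end
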